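(* For a set $X$ of real numbers, the following are equivalent: (1) $X$ satisfies $\mathsf{U}_{fin}(\mathcal{B}_\Gamma,\mathcal{B}_\mathrm{T})$; (2) every Borel image of $X$ in $\mathbb{N}^\mathbb{N}$ satisfies the excluded middle property.
   Context: All spaces $X$ are infinite sets of reals; all covers considered are assumed not to contain $X$ as a member. A cover is a $\gamma$-cover of $X$ if it is infinite and each point lies in all but finitely many members; large if each point lies in infinitely many members. A large cover $\mathcal{U}$ is a $\tau$-cover if for all $x,y\in X$, either ($x\in U\Rightarrow y\in U$) for all but finitely many $U\in\mathcal{U}$, or ($y\in U\Rightarrow x\in U$) for all but finitely many $U\in\mathcal{U}$. $\mathcal{B}_\Gamma,\mathcal{B}_\mathrm{T}$ are the collections of countable Borel $\gamma$-, $\tau$-covers. $X$ satisfies $\mathsf{U}_{fin}(\mathcal{B}_\Gamma,\mathcal{B}_\mathrm{T})$ if for every sequence $(\mathcal{U}_n)$ of members of $\mathcal{B}_\Gamma$ none of which contains a finite subcover, there are finite (possibly empty) $\mathcal{F}_n\subseteq\mathcal{U}_n$ such that $\{\bigcup\mathcal{F}_n:n\in\mathbb{N}\}\in\mathcal{B}_\mathrm{T}$. $f\le^*g$ means $f(n)\le g(n)$ for all but finitely many $n$. A family $Y\subseteq\mathbb{N}^\mathbb{N}$ satisfies the excluded middle property if there is $g\in\mathbb{N}^\mathbb{N}$ such that (i) $g\not\le^* f$ for all $f\in Y$, and (ii) for all $f,h\in Y$, at least one of the situations "$f(n)<g(n)\le h(n)$" and "$h(n)<g(n)\le f(n)$"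 occurs for only finitely many $n$. A Borel image of $X$ in $Z$ is $f[X]$ for a Borel $f:X\to Z$. *)

theory Defs
  imports "HOL-Analysis.Analysis"
begin

text \<open>
  Covers of a space \<open>X\<close> consist of subsets of \<open>X\<close> and never have \<open>X\<close> itself as a member.
\<close>

definition cover :: "'a set \<Rightarrow> 'a set set \<Rightarrow> bool" where
  "cover X \<U> \<longleftrightarrow> \<U> \<subseteq> Pow X \<and> \<Union>\<U> = X \<and> X \<notin> \<U>"

definition gamma_cover :: "'a set \<Rightarrow> 'a set set \<Rightarrow> bool" where
  "gamma_cover X \<U> \<longleftrightarrow> cover X \<U> \<and> infinite \<U> \<and> (\<forall>x\<in>X. finite {U \<in> \<U>. x \<notin> U})"

definition large_cover :: "'a set \<Rightarrow> 'a set set \<Rightarrow> bool" where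
  "large_cover X \<U> \<longleftrightarrow> cover X \<U> \<and> (\<forall>x\<in>X. infinite {U \<in> \<U>. x \<in> U})"

definition tau_cover :: "'a set \<Rightarrow> 'a set set \<Rightarrow> bool" where
  "tau_cover X \<U> \<longleftrightarrow> large_cover X \<U> \<and>
     (\<forall>x\<in>X. \<forall>y\<in>X. finite {U \<in> \<U>. \<not> (x \<in> U \<longrightarrow> y \<in> U)} \<or>
                    finite {U \<in> \<U>. \<not> (y \<in> U \<longrightarrow> x \<in> U)})"

text \<open>
  \<open>sets (restrict_space borel X)\<close> is the Borel algebra of the subspace \<open>X\<close>; the set \<open>X\<close> itself
  need not be Borel in the ambient space.
\<close>

definition borel_Gamma :: "'a::topological_space set \<Rightarrow> 'a set set set" where
  "borel_Gamma X =
     {\<U>. countable \<U> \<and> \<U> \<subseteq> sets (restrict_space borel X) \<and> gamma_cover X \<U>}"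

definition borel_Tau :: "'a::topological_space set \<Rightarrow> 'a set set set" where
  "borel_Tau X =
     {\<U>. countable \<U> \<and> \<U> \<subseteq> sets (restrict_space borel X) \<and> tau_cover X \<U>}"

definition U_fin :: "'a set \<Rightarrow> 'a set set set \<Rightarrow> 'a set set set \<Rightarrow> bool" where
  "U_fin X \<AA> \<BB> \<longleftrightarrow>
     (\<forall>\<U> :: nat \<Rightarrow> 'a set set.
        (\<forall>n. \<U> n \<in> \<AA> \<and> \<not> (\<exists>\<V>. \<V> \<subseteq> \<U> n \<and> finite \<V> \<and> \<Union>\<V> = X)) \<longrightarrow>
        (\<exists>\<F> :: nat \<Rightarrow> 'a set set.
           (\<forall>n. finite (\<F> n) \<and> \<F> n \<subseteq> \<U> n) \<and> {\<Union>(\<F> n) | n. True} \<in> \<BB>))"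

definition le_star :: "(nat \<Rightarrow> nat) \<Rightarrow> (nat \<Rightarrow> nat) \<Rightarrow> bool" (infix "\<le>\<^sup>*" 50) where
  "f \<le>\<^sup>* g \<longleftrightarrow> finite {n. \<not> f n \<le> g n}"

definition excluded_middle_property :: "(nat \<Rightarrow> nat) set \<Rightarrow> bool" where
  "excluded_middle_property Y \<longleftrightarrow>
     (\<exists>g. (\<forall>f\<in>Y. \<not> g \<le>\<^sup>* f) \<and>
          (\<forall>f\<in>Y. \<forall>h\<in>Y. finite {n. f n < g n \<and> g n \<le> h n} \<or>
                          finite {n. h n < g n \<and> g n \<le> f n}))"

text \<open>
  The function values outside \<open>X\<close> are irrelevant, so \<open>f\<close> ranges exactly over the Borel maps
  \<open>X \<rightarrow> Z\<close>. For \<open>Z = (nat \<Rightarrow> nat)\<close> the topology underlying \<open>borel\<close> is the product topology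
  with \<open>nat\<close> discrete.
\<close>

definition borel_image :: "'a::topological_space set \<Rightarrow> 'b::topological_space set \<Rightarrow> bool" where
  "borel_image X Y \<longleftrightarrow> (\<exists>f \<in> borel_measurable (restrict_space borel X). Y = f ` X)"

end

theory Submission
  imports Defs
begin

text \<open>
  A sequence of sets \<open>V n\<close> corresponds to a function \<open>g\<close> via \<open>V n = {x \<in> X. f x n < g n}\<close>: condition (i)
  says that each point lies in infinitely many \<open>V n\<close>, and (ii) that any two points are comparable in the
  sense of \<open>\<tau>\<close>-covers. The correspondence concerns indexed families, while covers are sets of sets, so
  repetitions of \<open>V n\<close> must be handled. From functions to covers, comparability implies that each
  finite set of points lies in some \<open>V n\<close>; since no \<open>V n\<close> is \<open>X\<close>, this prevents a point from lying in
  only finitely many distinct \<open>V n\<close>. From covers to functions, one index is kept for each member of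
  the cover, and \<open>g\<close> is set to \<open>0\<close> at all others.
\<close>

text \<open>Modulo finitely many indices, comparability orders the points linearly, so a finite
  nonempty set has a least point \<open>z\<close>: for almost all \<open>n\<close>, if
  \<open>V n\<close> contains \<open>z\<close>, it contains all of \<open>F\<close>. As
  \<open>z\<close> lies in infinitely many \<open>V n\<close>, one of them contains
  \<open>F\<close>.\<close>

lemma finite_subset_member_sequence:
  fixes V :: "nat \<Rightarrow> 'a set"
  assumes inf: "\<And>x. x \<in> X \<Longrightarrow> infinite {n. x \<in> V n}"
    and cmp: "\<And>x y. x \<in> X \<Longrightarrow> y \<in> X \<Longrightarrow>
      finite {n. x \<in> V n \<and> y \<notin> V n} \<or> finite {n. y \<in> V n \<and> x \<notin> V n}"
    and F: "finite F" "F \<noteq> {}" "F \<subseteq> X"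
  shows "\<exists>n. F \<subseteq> V n"
proof -
  from F have "\<exists>z\<in>F. finite {n. z \<in> V n \<and> \<not> F \<subseteq> V n}"
  proof (induction F rule: finite_ne_induct)
    case (singleton x)
    show ?case by simp
  next
    case (insert x F)
    then obtain z where z: "z \<in> F" "finite {n. z \<in> V n \<and> \<not> F \<subseteq> V n}" by auto
    from z(1) insert.prems have "x \<in> X" "z \<in> X" by auto
    \<comment> \<open>The new least point is \<open>x\<close> or the old \<open>z\<close>, whichever
      is almost below the other.\<close>
    from cmp[OF this] show ?case
    proof
      assume "finite {n. x \<in> V n \<and> z \<notin> V n}"
      with z(2) have "finite ({n. x \<in> V n \<and> z \<notin> V n} \<union> {n. z \<in> V n \<and> \<not> F \<subseteq> V n})" by simp
      then have "finite {n. x \<in> V n \<and> \<not> insert x F \<subseteq> V n}"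
        by (rule rev_finite_subset) auto
      then show ?thesis by blast
    next
      assume "finite {n. z \<in> V n \<and> x \<notin> V n}"
      with z(2) have "finite ({n. z \<in> V n \<and> x \<notin> V n} \<union> {n. z \<in> V n \<and> \<not> F \<subseteq> V n})" by simp
      then have "finite {n. z \<in> V n \<and> \<not> insert x F \<subseteq> V n}"
        by (rule rev_finite_subset) auto
      with z(1) show ?thesis by blast
    qed
  qed
  then obtain z where z: "z \<in> F" "finite {n. z \<in> V n \<and> \<not> F \<subseteq> V n}" by auto
  have "infinite ({n. z \<in> V n} - {n. z \<in> V n \<and> \<not> F \<subseteq> V n})"
    using inf z F(3) by (intro Diff_infinite_finite) auto
  then have "{n. z \<in> V n} - {n. z \<in> V n \<and> \<not> F \<subseteq> V n} \<noteq> {}" by (metis finite.emptyI)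
  then show ?thesis by auto
qed

lemma tau_cover_range:
  fixes V :: "nat \<Rightarrow> 'a set"
  assumes V: "\<And>n. V n \<subset> X"
    and inf: "\<And>x. x \<in> X \<Longrightarrow> infinite {n. x \<in> V n}"
    and cmp: "\<And>x y. x \<in> X \<Longrightarrow> y \<in> X \<Longrightarrow>
      finite {n. x \<in> V n \<and> y \<notin> V n} \<or> finite {n. y \<in> V n \<and> x \<notin> V n}"
  shows "tau_cover X (range V)"
proof -
  have large: "infinite {U \<in> range V. x \<in> U}" if "x \<in> X" for x
  proof
    assume fin: "finite {U \<in> range V. x \<in> U}"
    \<comment> \<open>Choose for each member a point \<open>y U\<close> that it misses. If only
      finitely many members contained \<open>x\<close>, some \<open>V n\<close> would contain
      \<open>x\<close> and all their missed points; being itself one of these members, it would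
      contain its own missed point.\<close>
    have "\<forall>U\<in>range V. \<exists>y. y \<in> X \<and> y \<notin> U" using V by blast
    from bchoice[OF this] obtain y where y: "\<forall>U\<in>range V. y U \<in> X \<and> y U \<notin> U" ..
    have "\<exists>n. insert x (y ` {U \<in> range V. x \<in> U}) \<subseteq> V n"
      using inf cmp fin that y by (intro finite_subset_member_sequence[of X]) auto
    then obtain n where n: "x \<in> V n" "y ` {U \<in> range V. x \<in> U} \<subseteq> V n" by auto
    then have "y (V n) \<in> V n" by blast
    with y show False by blast
  qed
  have "\<Union>(range V) = X"
  proof
    show "X \<subseteq> \<Union>(range V)" using inf not_finite_existsD by fastforce
  qed (use V in blast)
  \<comment> \<open>The offending members are the images under \<open>V\<close> of the offending
    indices, so repetitions can only reduce their number.\<close>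
  moreover have "finite {U \<in> range V. \<not> (x \<in> U \<longrightarrow> y \<in> U)}"
    if "finite {n. x \<in> V n \<and> y \<notin> V n}" for x y
    by (rule finite_subset[OF _ finite_imageI[OF that, of V]]) auto
  ultimately show ?thesis
    unfolding tau_cover_def large_cover_def cover_def using V large cmp by blast
qed

lemma excluded_middle_property_image:
  "excluded_middle_property (f ` X) \<longleftrightarrow>
    (\<exists>g. (\<forall>x\<in>X. infinite {n. f x n < g n}) \<and>
         (\<forall>x\<in>X. \<forall>y\<in>X. finite {n. f x n < g n \<and> g n \<le> f y n} \<or>
                         finite {n. f y n < g n \<and> g n \<le> f x n}))"
  by (simp add: excluded_middle_property_def le_star_def not_le)

lemma excluded_middle_imp_U_fin:
  fixes X :: "'a::topological_space set"
  assumes "\<And>Y :: (nat \<Rightarrow> nat) set. borel_image X Y \<Longrightarrow> excluded_middle_property Y"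
  shows "U_fin X (borel_Gamma X) (borel_Tau X)"
  unfolding U_fin_def
proof (intro allI impI)
  fix \<U> :: "nat \<Rightarrow> 'a set set"
  let ?M = "restrict_space borel X"
  assume "\<forall>n. \<U> n \<in> borel_Gamma X \<and> \<not> (\<exists>\<V>. \<V> \<subseteq> \<U> n \<and> finite \<V> \<and> \<Union>\<V> = X)"
  then have \<U>: "countable (\<U> n)" "\<U> n \<subseteq> sets ?M" "\<U> n \<subseteq> Pow X" "\<Union>(\<U> n) = X" "infinite (\<U> n)"
    and nofin: "\<And>\<V>. \<V> \<subseteq> \<U> n \<Longrightarrow> finite \<V> \<Longrightarrow> \<Union>\<V> \<noteq> X" for n
    by (auto simp: borel_Gamma_def gamma_cover_def cover_def)
  define u where "u n = from_nat_into (\<U> n)" for n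
  have u: "range (u n) = \<U> n" for n
    using \<U>[of n] unfolding u_def by (intro range_from_nat_into) auto
  \<comment> \<open>The index of the first member containing \<open>x\<close> is recorded, so that
    the union of the first \<open>m\<close> members of the enumeration is exactly the set where
    \<open>f x n < m\<close>.\<close>
  define f where "f x n = (LEAST k. x \<in> u n k)" for x n
  have f_less: "f x n < m \<longleftrightarrow> (\<exists>k<m. x \<in> u n k)" if "x \<in> X" for x n m
  proof
    have "\<exists>k. x \<in> u n k" using that \<U>(4)[of n] u[of n] by blast
    then have "x \<in> u n (f x n)" unfolding f_def by (rule LeastI_ex)
    then show "f x n < m \<Longrightarrow> \<exists>k<m. x \<in> u n k" by blast
    show "\<exists>k<m. x \<in> u n k \<Longrightarrow> f x n < m"
      unfolding f_def using Least_le le_less_trans by metis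
  qed
  have u_sets: "u n k \<in> sets ?M" for n k using \<U>(2)[of n] u[of n] by blast
  have "f \<in> borel_measurable ?M"
  proof (rule measurable_coordinatewise_then_product)
    fix n
    have [measurable]: "\<And>k. Measurable.pred ?M (\<lambda>x. x \<in> u n k)"
      using u_sets by (simp add: pred_sets2)
    have "(\<lambda>x. f x n) \<in> measurable ?M (count_space UNIV)"
      unfolding f_def by measurable
    then show "(\<lambda>x. f x n) \<in> borel_measurable ?M"
      by (simp add: measurable_cong_sets[OF refl sets_borel_eq_count_space])
  qed
  then have "excluded_middle_property (f ` X)"
    using assms unfolding borel_image_def by blast
  then obtain g where g: "(\<forall>x\<in>X. infinite {n. f x n < g n}) \<and>
      (\<forall>x\<in>X. \<forall>y\<in>X. finite {n. f x n < g n \<and> g n \<le> f y n} \<or>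
                      finite {n. f y n < g n \<and> g n \<le> f x n})"
    unfolding excluded_middle_property_image ..
  \<comment> \<open>The value \<open>g n = 0\<close> yields the empty subfamily, which the selection
    principle allows.\<close>
  define \<F> where "\<F> n = u n ` {..<g n}" for n
  have \<F>: "finite (\<F> n)" "\<F> n \<subseteq> \<U> n" for n using u[of n] by (auto simp: \<F>_def)
  have mem: "x \<in> \<Union>(\<F> n) \<longleftrightarrow> f x n < g n" if "x \<in> X" for x n
    using f_less[OF that] by (auto simp: \<F>_def)
  have "tau_cover X (range (\<lambda>n. \<Union>(\<F> n)))"
  proof (rule tau_cover_range)
    \<comment> \<open>The inclusion is strict because \<open>\<U> n\<close> has no finite
      subcover.\<close>
    show "\<Union>(\<F> n) \<subset> X" for n
      using \<F>[of n] nofin[of "\<F> n" n] \<U>(3)[of n] by blast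
  qed (use g in \<open>simp_all only: mem not_less not_False_eq_True\<close>)
  moreover have "\<Union>(\<F> n) \<in> sets ?M" for n
    using \<F>[of n] \<U>(2)[of n] by (intro sets.finite_Union) auto
  moreover have "{\<Union>(\<F> n) | n. True} = range (\<lambda>n. \<Union>(\<F> n))" by auto
  ultimately have "{\<Union>(\<F> n) | n. True} \<in> borel_Tau X" by (auto simp: borel_Tau_def)
  with \<F> show "\<exists>\<F>. (\<forall>n. finite (\<F> n) \<and> \<F> n \<subseteq> \<U> n) \<and> {\<Union>(\<F> n) | n. True} \<in> borel_Tau X"
    by blast
qed

text \<open>This supplies the covers to which the selection principle is applied. A point
  \<open>x\<close> is missed only by the sublevel sets with \<open>m \<le> f x\<close>.
  Unboundedness rules out finite subcovers, hence also that the cover is finite or contains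
  \<open>X\<close>.\<close>

lemma sublevel_sets_borel_Gamma:
  fixes f :: "'a::topological_space \<Rightarrow> nat"
  assumes f: "f \<in> borel_measurable (restrict_space borel X)"
    and unbdd: "\<And>m. \<exists>x\<in>X. m \<le> f x"
  defines "\<U> \<equiv> range (\<lambda>m. {x \<in> X. f x < m})"
  shows "\<U> \<in> borel_Gamma X"
    and "\<V> \<subseteq> \<U> \<Longrightarrow> finite \<V> \<Longrightarrow> \<Union>\<V> \<noteq> X"
proof -
  have nofin: "\<Union>\<V> \<noteq> X" if \<V>: "\<V> \<subseteq> \<U>" "finite \<V>" for \<V>
  proof -
    obtain K where K: "finite K" "\<V> = (\<lambda>m. {x \<in> X. f x < m}) ` K"
      using finite_subset_image[OF \<V>(2) \<V>(1)[unfolded \<U>_def]] by blast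
    \<comment> \<open>For empty \<open>K\<close> the value of \<open>Max K\<close> is immaterial:
      any point of \<open>X\<close> lies outside the empty union.\<close>
    obtain x where x: "x \<in> X" "Max K \<le> f x" using unbdd by blast
    have "\<not> f x < k" if "k \<in> K" for k using Max_ge[OF K(1) that] x(2) by simp
    then have "x \<notin> \<Union>\<V>" by (auto simp: K(2))
    with x(1) show ?thesis by blast
  qed
  then show "\<V> \<subseteq> \<U> \<Longrightarrow> finite \<V> \<Longrightarrow> \<Union>\<V> \<noteq> X" .
  have Un: "\<Union>\<U> = X" by (auto simp: \<U>_def)
  have "infinite \<U>" using nofin Un by blast
  moreover have "X \<notin> \<U>" using nofin[of "{X}"] by auto
  moreover have "finite {U \<in> \<U>. x \<notin> U}" if "x \<in> X" for x
  proof (rule finite_subset)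
    show "{U \<in> \<U>. x \<notin> U} \<subseteq> (\<lambda>m. {x \<in> X. f x < m}) ` {..f x}"
      using that by (auto simp: \<U>_def)
  qed simp
  moreover have "\<U> \<subseteq> sets (restrict_space borel X)"
  proof -
    have "f -` {..<m} \<inter> space (restrict_space borel X) \<in> sets (restrict_space borel X)" for m
      using f by (rule measurable_sets) auto
    moreover have "f -` {..<m} \<inter> space (restrict_space borel X) = {x \<in> X. f x < m}" for m
      by (auto simp: space_restrict_space)
    ultimately show ?thesis by (auto simp: \<U>_def)
  qed
  moreover have "countable \<U>" by (simp add: \<U>_def)
  moreover have "\<U> \<subseteq> Pow X" by (auto simp: \<U>_def)
  ultimately show "\<U> \<in> borel_Gamma X"
    using Un by (simp add: borel_Gamma_def gamma_cover_def cover_def)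
qed

lemma U_fin_imp_excluded_middle:
  fixes X :: "'a::topological_space set" and Y :: "(nat \<Rightarrow> nat) set"
  assumes U_fin: "U_fin X (borel_Gamma X) (borel_Tau X)" and "borel_image X Y"
  shows "excluded_middle_property Y"
proof -
  obtain f where f: "f \<in> borel_measurable (restrict_space borel X)" and Y: "Y = f ` X"
    using assms(2) by (auto simp: borel_image_def)
  \<comment> \<open>These are the coordinates on which \<open>f\<close> is bounded over
    \<open>X\<close>. There some sublevel set is all of \<open>X\<close>, so the sublevel sets give
    no admissible cover.\<close>
  define B where "B = {n. \<exists>b. \<forall>x\<in>X. f x n < b}"
  have emI: "excluded_middle_property Y"
    if "\<And>x. x \<in> X \<Longrightarrow> infinite {n. f x n < g n}"
      and "\<And>x y. x \<in> X \<Longrightarrow> y \<in> X \<Longrightarrow> finite {n. f x n < g n \<and> g n \<le> f y n} \<or>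
                          finite {n. f y n < g n \<and> g n \<le> f x n}" for g
    unfolding Y excluded_middle_property_image using that by (intro exI[of _ g]) simp
  show ?thesis
  proof (cases "finite B")
    case False
    have "\<forall>n\<in>B. \<exists>b. \<forall>x\<in>X. f x n < b" by (simp add: B_def)
    then obtain b where b: "\<And>n x. n \<in> B \<Longrightarrow> x \<in> X \<Longrightarrow> f x n < b n"
      by (auto dest!: bchoice)
    \<comment> \<open>With this choice, \<open>f x n < g n\<close> holds exactly when
      \<open>n \<in> B\<close>, whatever the point \<open>x\<close>, so any two points are trivially
      comparable.\<close>
    define g where "g n = (if n \<in> B then b n else 0)" for n
    show ?thesis
    proof (rule emI[of g])
      show "infinite {n. f x n < g n}" if "x \<in> X" for x
        using that b False by (auto simp: g_def elim!: infinite_super[rotated])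
      have "{n. f x n < g n \<and> g n \<le> f y n} = {}" if "x \<in> X" "y \<in> X" for x y
        using b[OF _ that(2)] by (auto simp: g_def not_le)
      then show "finite {n. f x n < g n \<and> g n \<le> f y n} \<or> finite {n. f y n < g n \<and> g n \<le> f x n}"
        if "x \<in> X" "y \<in> X" for x y using that by (metis finite.emptyI)
    qed
  next
    case True
    then obtain n0 where n0: "n0 \<notin> B" using ex_new_if_finite infinite_UNIV_nat by blast
    \<comment> \<open>A cover is needed at every index, so the finitely many bounded coordinates are
      replaced by one fixed unbounded coordinate \<open>n0\<close>. The indices in \<open>B\<close>
      are discarded again when \<open>g\<close> is defined.\<close>
    define h where "h n = (if n \<in> B then n0 else n)" for n
    define \<U> where "\<U> n = range (\<lambda>m. {x \<in> X. f x (h n) < m})" for n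
    have meas: "(\<lambda>x. f x (h n)) \<in> borel_measurable (restrict_space borel X)" for n
      using f by (rule measurable_product_then_coordinatewise)
    have unbdd: "\<exists>x\<in>X. m \<le> f x (h n)" for n m
      using n0 unfolding h_def B_def by (auto simp: not_less[symmetric])
    have "\<exists>\<F>. (\<forall>n. finite (\<F> n) \<and> \<F> n \<subseteq> \<U> n) \<and> {\<Union>(\<F> n) | n. True} \<in> borel_Tau X"
    proof (rule U_fin[unfolded U_fin_def, rule_format], intro conjI notI)
      show "\<U> n \<in> borel_Gamma X" for n
        unfolding \<U>_def using meas unbdd by (rule sublevel_sets_borel_Gamma(1))
      show False if "\<exists>\<V>\<subseteq>\<U> n. finite \<V> \<and> \<Union>\<V> = X" for n
        using that sublevel_sets_borel_Gamma(2)[OF meas unbdd] unfolding \<U>_def by blast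
    qed
    then obtain \<F> where \<F>: "\<And>n. finite (\<F> n)" "\<And>n. \<F> n \<subseteq> \<U> n"
      and tau: "{\<Union>(\<F> n) | n. True} \<in> borel_Tau X"
      by blast
    define V where "V n = \<Union>(\<F> n)" for n
    have "{\<Union>(\<F> n) | n. True} = range V" by (auto simp: V_def)
    with tau have tau_V: "tau_cover X (range V)" by (simp add: borel_Tau_def)
    \<comment> \<open>A finite union of sublevel sets is the one with the largest bound; the empty
      union is the sublevel set at 0.\<close>
    have "\<exists>m. \<forall>x\<in>X. x \<in> V n \<longleftrightarrow> f x (h n) < m" for n
    proof -
      obtain K where K: "finite K" "\<F> n = (\<lambda>m. {x \<in> X. f x (h n) < m}) ` K"
        using finite_subset_image[OF \<F>(1) \<F>(2)[unfolded \<U>_def]] by blast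
      show ?thesis
      proof (cases "K = {}")
        case False
        have "x \<in> V n \<longleftrightarrow> f x (h n) < Max K" if "x \<in> X" for x
          using that by (simp add: V_def K(2) Max_gr_iff[OF K(1) False])
        then show ?thesis by blast
      qed (auto simp: V_def K(2))
    qed
    then have "\<forall>n. \<exists>m. \<forall>x\<in>X. x \<in> V n \<longleftrightarrow> f x (h n) < m" by blast
    from choice[OF this] obtain G where G: "\<forall>n. \<forall>x\<in>X. x \<in> V n \<longleftrightarrow> f x (h n) < G n" ..
    obtain A where A: "inj_on V A" "V ` A = range V"
      using subset_image_inj[of "range V" V UNIV] by auto
    \<comment> \<open>Outside \<open>B\<close> one has \<open>h n = n\<close>, so \<open>G n\<close>
      bounds the original coordinate; the value 0 makes \<open>f x n < g n\<close> fail at every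
      other index.\<close>
    define g where "g n = (if n \<in> A - B then G n else 0)" for n
    have g: "f x n < g n \<longleftrightarrow> n \<in> A - B \<and> x \<in> V n" if "x \<in> X" for x n
      using G that by (simp add: g_def h_def)
    show ?thesis
    proof (rule emI[of g])
      fix x assume x: "x \<in> X"
      have "infinite {U \<in> range V. x \<in> U}"
        using tau_V x unfolding tau_cover_def large_cover_def by blast
      moreover have "{U \<in> range V. x \<in> U} \<subseteq> V ` {n \<in> A. x \<in> V n}"
        unfolding A(2)[symmetric] by blast
      ultimately have "infinite (V ` {n \<in> A. x \<in> V n})" using infinite_super by blast
      then have "infinite {n \<in> A. x \<in> V n}" by (rule contrapos_nn) (rule finite_imageI)
      \<comment> \<open>Dropping \<open>B\<close> costs only finitely many indices.\<close>
      then have "infinite ({n \<in> A. x \<in> V n} - B)" by (rule Diff_infinite_finite[OF True])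
      moreover have "{n \<in> A. x \<in> V n} - B = {n. f x n < g n}" unfolding g[OF x] by blast
      ultimately show "infinite {n. f x n < g n}" by simp
    next
      fix x y assume xy: "x \<in> X" "y \<in> X"
      have "finite {n. f x n < g n \<and> g n \<le> f y n}"
        if fin: "finite {U \<in> range V. \<not> (x \<in> U \<longrightarrow> y \<in> U)}" and xy: "x \<in> X" "y \<in> X" for x y
      proof (rule finite_subset)
        show "{n. f x n < g n \<and> g n \<le> f y n} \<subseteq> V -` {U \<in> range V. \<not> (x \<in> U \<longrightarrow> y \<in> U)} \<inter> A"
          unfolding not_less[symmetric] g[OF xy(1)] g[OF xy(2)] by blast
        \<comment> \<open>Since \<open>V\<close> is injective on \<open>A\<close>, finitely many
          offending members come from finitely many indices in \<open>A\<close>.\<close>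
        show "finite (V -` {U \<in> range V. \<not> (x \<in> U \<longrightarrow> y \<in> U)} \<inter> A)"
          using fin A(1) by (rule finite_vimage_IntI)
      qed
      moreover have "finite {U \<in> range V. \<not> (x \<in> U \<longrightarrow> y \<in> U)} \<or>
          finite {U \<in> range V. \<not> (y \<in> U \<longrightarrow> x \<in> U)}"
        using tau_V xy unfolding tau_cover_def by blast
      ultimately show "finite {n. f x n < g n \<and> g n \<le> f y n} \<or> finite {n. f y n < g n \<and> g n \<le> f x n}"
        using xy by blast
    qed
  qed
qed

theorem theorem3p11:
  fixes X :: "real set"
  assumes "infinite X"
  shows "U_fin X (borel_Gamma X) (borel_Tau X) \<longleftrightarrow>
    (\<forall>Y :: (nat \<Rightarrow> nat) set. borel_image X Y \<longrightarrow> excluded_middle_property Y)"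
  using U_fin_imp_excluded_middle excluded_middle_imp_U_fin by blast

end
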